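(* Let $\theta:(0,\infty)\to(0,\infty)$, $u_0:(0,\infty)\to\mathbb{R}$ and $f:[0,\infty)\times\mathbb{R}\times(0,\infty)\to\overline{\mathbb{R}}$ be such that for each $\lambda>0$, $\lim_{t\to\theta(\lambda),\,t<\theta(\lambda)}f(t,x,\lambda)=\pm\infty$ for almost all $x\in\mathbb{R}$. Assume the following. (i) For each $\lambda>0$ and $0<\varepsilon<\theta(\lambda)$ there is a constant $L(\lambda,\varepsilon)$ such that $|f(t,x,\lambda)-f(t,\overline{x},\lambda)|\le L(\lambda,\varepsilon)|x-\overline{x}|$ for all $x,\overline{x}\in\mathbb{R}$ and all $t\in[0,\theta(\lambda)-\varepsilon]$. (ii) The maps $\lambda\mapsto\theta(\lambda)$, $\lambda\mapsto u_0(\lambda)$ and, for each $\varepsilon>0$, $\lambda\mapsto L(\lambda,\varepsilon)$ are continuous, and $(t,x,\lambda)\mapsto f(t,x,\lambda)$ is continuous for $t\in[0,\theta(\lambda))$, $x\in\mathbb{R}$, $\lambda\in(0,\infty)$. (iii) There is a constant $a>1$ such that for all $\lambda>0$, $|f(t,x,\lambda)|\le\frac{|x|}{a(\theta(\lambda)-t)}+C_\lambda$ for all $t\in[0,\theta(\lambda))$ and all $x\in\mathbb{R}$, where $C_\lambda\ge 0$ and $\lambda\mapsto C_\lambda$ is continuous. For $\lambda>0$ let $u_\lambda\in C[0,\theta(\lambda))$ be the unique solution of $u'(t)=f(t,u(t),\lambda)$, $t\in[0,\theta(\lambda))$, $u(0)=u_0(\lambda)$. Then the mapping $$\varphi:(0,\infty)\to\mathbb{R},\qquad\varphi(\lambda)=\int_0^{\theta(\lambda)}u_\lambda(s)\,ds$$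 is well-defined (the improper integral converges to a real number for every $\lambda>0$) and continuous.
   Context: $\overline{\mathbb{R}}=\mathbb{R}\cup\{\pm\infty\}$; $f$ is real-valued for $t\in[0,\theta(\lambda))$. The map $\lambda\mapsto L(\lambda,\varepsilon)$ is considered for those $\lambda$ with $\theta(\lambda)>\varepsilon$. Under (i) and (ii) the initial value problem has, for each $\lambda>0$, a unique solution $u_\lambda\in C[0,\theta(\lambda))$. Integrals over $[0,\theta(\lambda))$ are improper: $\int_0^{\theta(\lambda)}u(s)\,ds=\lim_{t\to\theta(\lambda),\,t<\theta(\lambda)}\int_0^t u(s)\,ds$. *)

theory Defs
  imports "HOL-Analysis.Analysis"
begin

(* The derivative is one-sided at t = 0.  Since u is a real function, the equation with D real
   forces F t (u t) to be finite along a solution. *)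
definition ivp_solution ::
    "(real \<Rightarrow> real \<Rightarrow> ereal) \<Rightarrow> real \<Rightarrow> real \<Rightarrow> (real \<Rightarrow> real) \<Rightarrow> bool" where
  "ivp_solution F T x0 u \<longleftrightarrow>
     continuous_on {0..<T} u \<and> u 0 = x0 \<and>
     (\<forall>t\<in>{0..<T}. \<exists>D. (u has_real_derivative D) (at t within {0..<T}) \<and> ereal D = F t (u t))"

(* Functions are total, so uniqueness can only be asked for on [0,T). *)
definition unique_ivp_solution ::
    "(real \<Rightarrow> real \<Rightarrow> ereal) \<Rightarrow> real \<Rightarrow> real \<Rightarrow> (real \<Rightarrow> real) \<Rightarrow> bool" where
  "unique_ivp_solution F T x0 u \<longleftrightarrow>
     ivp_solution F T x0 u \<and> (\<forall>v. ivp_solution F T x0 v \<longrightarrow> (\<forall>t\<in>{0..<T}. v t = u t))"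

definition improper_integral_converges :: "real \<Rightarrow> (real \<Rightarrow> real) \<Rightarrow> bool" where
  "improper_integral_converges T u \<longleftrightarrow>
     (\<forall>t\<in>{0..<T}. u integrable_on {0..t}) \<and>
     (\<exists>I::real. ((\<lambda>t. integral {0..t} u) \<longlongrightarrow> I) (at_left T))"

definition improper_integral :: "real \<Rightarrow> (real \<Rightarrow> real) \<Rightarrow> real" where
  "improper_integral T u = Lim (at_left T) (\<lambda>t. integral {0..t} u)"

end

theory Submission
  imports Defs
begin

text \<open>
  Rescaling time by \<open>t = \<tau> * \<theta> l\<close> turns the problems into the family
  \<open>v' = G \<tau> v l = \<theta> l * f (\<tau> * \<theta> l) v l\<close> on the fixed interval \<open>[0, 1)\<close>. On \<open>[0, T] \<times> K\<close> with \<open>T < 1\<close>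
  and \<open>K\<close> a compact set of parameters, \<open>G\<close> is Lipschitz in \<open>v\<close> with one constant \<open>\<Lambda>\<close>. The Picard
  iterates are jointly continuous in time and parameter (\<open>picard_jointly_continuous\<close>), and their
  increments are at most \<open>const * 2^(-n) * exp (2 * \<Lambda> * \<tau>)\<close> (\<open>picard_increment_le\<close>). Hence they
  converge uniformly on \<open>[0, T] \<times> K\<close> (\<open>picard_uniform_limit\<close>), which gives existence on all of
  \<open>[0, 1)\<close> and joint continuity of the solution \<open>v \<tau> l\<close> at once. Uniqueness is the usual energy
  argument (\<open>ode_solution_unique\<close>).

  What remains is the behaviour at the singular end. Choose \<open>b\<close> with \<open>1 / a < b < 1\<close>. The growth
  condition makes \<open>M * (1 - \<tau>) powr (-b)\<close> a supersolution as soon as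
  \<open>M = \<bar>u0 l\<bar> + \<theta> l * C l / (b - 1 / a)\<close>: the gap between \<open>b\<close> and \<open>1 / a\<close> absorbs the constant term.
  A supersolution bounds every Picard iterate by induction (\<open>picard_le_supersolution\<close>), so it
  bounds \<open>\<bar>v \<tau> l\<bar>\<close> (\<open>picard_limit_le_powr\<close>). Because \<open>b < 1\<close> this bound is integrable, and \<open>M\<close> is
  continuous in \<open>l\<close>; the integrals over \<open>[0, r]\<close> therefore converge, as \<open>r\<close> tends to \<open>1\<close>, uniformly
  for \<open>l\<close> in a compact set (\<open>integral_uniform_limit_of_powr_bound\<close>). Each of them is continuous in
  \<open>l\<close>, so the limit is, and \<open>\<phi> l\<close> is \<open>\<theta> l\<close> times that limit.
\<close>

section \<open>Two facts on integrals over an interval\<close>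

lemma abs_integral_le_primitive:
  fixes h B B' :: "real \<Rightarrow> real"
  assumes "0 \<le> t" and h: "continuous_on {0..t} h"
    and B: "\<And>s. s \<in> {0..t} \<Longrightarrow> (B has_real_derivative B' s) (at s within {0..t})"
    and le: "\<And>s. s \<in> {0..t} \<Longrightarrow> \<bar>h s\<bar> \<le> B' s"
  shows "\<bar>integral {0..t} h\<bar> \<le> B t - B 0"
proof -
  have "(B' has_integral (B t - B 0)) {0..t}"
    using assms(1) B
    by (intro fundamental_theorem_of_calculus) (auto simp flip: has_real_derivative_iff_has_vector_derivative)
  moreover have "h integrable_on {0..t}"
    using h by (rule integrable_continuous_interval)
  ultimately show ?thesis
    using integral_norm_bound_integral[of h "{0..t}" B'] le by (auto simp: has_integral_iff)
qed

lemma integral_rescale: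
  fixes h :: "real \<Rightarrow> real"
  assumes "0 \<le> c"
  shows "integral {0..c * r} h = c * integral {0..r} (\<lambda>s. h (c * s))"
proof (cases "c = 0")
  case False
  then have c: "0 < c" using assms by simp
  have "(\<lambda>x. x / c) ` {0..c * r} = {0..r}"
    using c by (auto simp: image_iff field_simps intro!: bexI[of _ "c * _"])
  then show ?thesis
    using integral_stretch_real[of c 0 "c * r" h] c by (simp add: field_simps)
qed simp

section \<open>Picard iteration with a parameter\<close>

text \<open>The Picard iterates for \<open>y' = F t y\<close>, \<open>y 0 = x0\<close>, starting from the constant function \<open>x0\<close>.\<close>

fun picard :: "(real \<Rightarrow> real \<Rightarrow> real) \<Rightarrow> real \<Rightarrow> nat \<Rightarrow> real \<Rightarrow> real" where
  "picard F x0 0 t = x0"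
| "picard F x0 (Suc n) t = x0 + integral {0..t} (\<lambda>s. F s (picard F x0 n s))"

text \<open>
  The pointwise limit of the iterates. It does not mention an interval, so solutions found on
  different intervals \<open>[0, T]\<close> agree by definition and need not be glued.
\<close>

definition picard_limit :: "(real \<Rightarrow> real \<Rightarrow> real) \<Rightarrow> real \<Rightarrow> real \<Rightarrow> real" where
  "picard_limit F x0 t = lim (\<lambda>n. picard F x0 n t)"

text \<open>
  The upper limit of integration depends on \<open>t\<close>; substituting \<open>s = t * \<sigma>\<close> moves the integral to the
  fixed interval \<open>[0, 1]\<close>, where continuity of parametric integrals applies.
\<close>

lemma picard_jointly_continuous:
  fixes G :: "real \<Rightarrow> real \<Rightarrow> 'p::topological_space \<Rightarrow> real"
  assumes G: "continuous_on ({0..T} \<times> UNIV \<times> K) (\<lambda>(t, x, p). G t x p)"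
    and x0: "continuous_on K x0"
  shows "continuous_on ({0..T} \<times> K) (\<lambda>(t, p). picard (\<lambda>s x. G s x p) (x0 p) n t)"
proof (induction n)
  case 0
  show ?case
    by (auto simp: split_beta intro!: continuous_intros continuous_on_compose2[OF x0])
next
  case (Suc n)
  let ?y = "\<lambda>t p. picard (\<lambda>s x. G s x p) (x0 p) n t"
  let ?h = "\<lambda>z s. G (fst z * s) (?y (fst z * s) (snd z)) (snd z)"
  have in_T: "t * s \<in> {0..T}" if "t \<in> {0..T}" "s \<in> {0..1}" for t s :: real
    using that mult_left_le[of s t] by (auto intro: order_trans)
  have y: "continuous_on (({0..T} \<times> K) \<times> cbox 0 1) (\<lambda>w. ?y (fst (fst w) * snd w) (snd (fst w)))"
    by (rule continuous_on_compose2[OF Suc.IH, where f = "\<lambda>w. (fst (fst w) * snd w, snd (fst w))", simplified])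
      (use in_T in \<open>auto intro!: continuous_intros\<close>)
  have "continuous_on (({0..T} \<times> K) \<times> cbox 0 1)
      (\<lambda>w. G (fst (fst w) * snd w) (?y (fst (fst w) * snd w) (snd (fst w))) (snd (fst w)))"
    by (rule continuous_on_compose2[OF G, where f = "\<lambda>w. (fst (fst w) * snd w,
          ?y (fst (fst w) * snd w) (snd (fst w)), snd (fst w))", simplified])
      (use in_T in \<open>auto intro!: continuous_intros y[simplified]\<close>)
  then have "continuous_on (({0..T} \<times> K) \<times> cbox 0 1) (\<lambda>(z, s). ?h z s)"
    by (simp add: split_beta)
  from integral_continuous_on_param[OF this]
  have "continuous_on ({0..T} \<times> K) (\<lambda>z. x0 (snd z) + fst z * integral {0..1} (?h z))"
    by (auto intro!: continuous_intros continuous_on_compose2[OF x0])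
  then show ?case
  proof (rule continuous_on_eq)
    fix z assume "z \<in> {0..T} \<times> K"
    then show "x0 (snd z) + fst z * integral {0..1} (?h z)
        = (case z of (t, p) \<Rightarrow> picard (\<lambda>s x. G s x p) (x0 p) (Suc n) t)"
      using integral_rescale[of "fst z" 1 "\<lambda>s. G s (?y s (snd z)) (snd z)"]
      by (auto simp: split_beta)
  qed
qed

lemma continuous_on_ignore_parameter:
  assumes F: "continuous_on ({0..T} \<times> UNIV) (\<lambda>(t, x). F t x)"
  shows "continuous_on ({0..T} \<times> UNIV \<times> K) (\<lambda>(t, x, p). F t x)"
  unfolding split_beta
  by (rule continuous_on_compose2[OF F, where f = "\<lambda>w. (fst w, fst (snd w))", simplified])
    (auto intro!: continuous_intros)

lemma picard_continuous:
  assumes F: "continuous_on ({0..T} \<times> UNIV) (\<lambda>(t, x). F t x)"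
  shows "continuous_on {0..T} (picard F x0 n)"
proof -
  have "continuous_on ({0..T} \<times> UNIV \<times> {0::real}) (\<lambda>(t, x, p). F t x)"
    by (rule continuous_on_ignore_parameter[OF F])
  then have "continuous_on ({0..T} \<times> {0::real}) (\<lambda>(t, p). picard F x0 n t)"
    by (rule picard_jointly_continuous) simp
  from continuous_on_compose2[OF this, where f = "\<lambda>t. (t, 0)" and s = "{0..T}"]
  show ?thesis
    by (simp add: image_subset_iff continuous_intros)
qed

lemma continuous_on_along_curve:
  assumes F: "continuous_on ({0..T} \<times> UNIV) (\<lambda>(t, x). F t x)"
    and y: "continuous_on {0..T} y"
  shows "continuous_on {0..T} (\<lambda>t::real. F t (y t :: real) :: real)"
  by (rule continuous_on_compose2[OF F, where f = "\<lambda>t. (t, y t)", simplified])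
    (auto intro!: continuous_intros y)

text \<open>
  A supersolution: if \<open>\<bar>F s x\<bar>\<close> is at most the derivative of \<open>B\<close> whenever \<open>\<bar>x\<bar>\<close> is at most \<open>B s\<close>, then
  integrating reproduces the bound \<open>B\<close> from one iterate to the next.
\<close>

lemma picard_le_supersolution:
  assumes F: "continuous_on ({0..T} \<times> UNIV) (\<lambda>(t, x). F t x)"
    and B: "\<And>s. s \<in> {0..T} \<Longrightarrow> (B has_real_derivative B' s) (at s within {0..T})"
    and B'_nonneg: "\<And>s. s \<in> {0..T} \<Longrightarrow> 0 \<le> B' s"
    and le: "\<And>s x. s \<in> {0..T} \<Longrightarrow> \<bar>x\<bar> \<le> B s \<Longrightarrow> \<bar>F s x\<bar> \<le> B' s"
    and x0: "\<bar>x0\<bar> \<le> B 0"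
    and t: "t \<in> {0..T}"
  shows "\<bar>picard F x0 n t\<bar> \<le> B t"
proof -
  have B_sub: "(B has_real_derivative B' s) (at s within {0..t})" if "s \<in> {0..t}" "t \<in> {0..T}" for s t
    by (rule DERIV_subset[OF B]) (use that in auto)
  show ?thesis
    using t
  proof (induction n arbitrary: t)
    case 0
    have "\<bar>integral {0..t} (\<lambda>_. 0::real)\<bar> \<le> B t - B 0"
      by (rule abs_integral_le_primitive[where B' = B'])
        (use 0 B'_nonneg in \<open>auto intro!: B_sub\<close>)
    with x0 show ?case by simp
  next
    case (Suc n)
    have "\<bar>integral {0..t} (\<lambda>s. F s (picard F x0 n s))\<bar> \<le> B t - B 0"
    proof (rule abs_integral_le_primitive[where B' = B'])
      show "continuous_on {0..t} (\<lambda>s. F s (picard F x0 n s))"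
        using continuous_on_along_curve[OF F picard_continuous[OF F]]
        by (rule continuous_on_subset) (use Suc.prems in auto)
    qed (use Suc le in \<open>auto intro!: B_sub simp del: picard.simps\<close>)
    with x0 show ?case by simp
  qed
qed

text \<open>
  The weight \<open>exp (2 * \<Lambda> * t)\<close> makes the Picard map a contraction with factor \<open>1 / 2\<close> on an interval
  of any length: integrating \<open>\<Lambda>\<close> times the weight gives at most half of it.
\<close>

lemma picard_increment_le:
  assumes F: "continuous_on ({0..T} \<times> UNIV) (\<lambda>(t, x). F t x)"
    and lip: "\<And>s x y. s \<in> {0..T} \<Longrightarrow> \<bar>F s x - F s y\<bar> \<le> \<Lambda> * \<bar>x - y\<bar>"
    and \<Lambda>: "0 < \<Lambda>"
    and A: "\<And>s. s \<in> {0..T} \<Longrightarrow> \<bar>F s x0\<bar> \<le> A"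
    and t: "t \<in> {0..T}"
  shows "\<bar>picard F x0 (Suc n) t - picard F x0 n t\<bar> \<le> A / (2 * \<Lambda>) * (1/2) ^ n * exp (2 * \<Lambda> * t)"
  using t
proof (induction n arbitrary: t)
  case 0
  have A0: "0 \<le> A" using A[OF 0] by linarith
  let ?B = "\<lambda>s. A / (2 * \<Lambda>) * exp (2 * \<Lambda> * s)"
  have "\<bar>integral {0..t} (\<lambda>s. F s x0)\<bar> \<le> ?B t - ?B 0"
  proof (rule abs_integral_le_primitive[where B' = "\<lambda>s. A * exp (2 * \<Lambda> * s)"])
    show "continuous_on {0..t} (\<lambda>s. F s x0)"
      using continuous_on_along_curve[OF F, of "\<lambda>_. x0"] 0 by (auto intro: continuous_on_subset)
    show "(?B has_real_derivative A * exp (2 * \<Lambda> * s)) (at s within {0..t})" for s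
      using \<Lambda> by (auto intro!: derivative_eq_intros)
    show "\<bar>F s x0\<bar> \<le> A * exp (2 * \<Lambda> * s)" if "s \<in> {0..t}" for s
      using A[of s] 0 that \<Lambda> A0 mult_left_mono[of 1 "exp (2 * \<Lambda> * s)" A] by auto
  qed (use 0 in auto)
  also have "\<dots> \<le> ?B t" using A0 \<Lambda> by simp
  finally show ?case by simp
next
  case (Suc n)
  let ?y = "picard F x0"
  let ?c = "A / (2 * \<Lambda>) * (1/2) ^ n"
  let ?B = "\<lambda>s. ?c / 2 * exp (2 * \<Lambda> * s)"
  have A0: "0 \<le> A" using A[OF Suc.prems] by linarith
  have cont: "continuous_on {0..t} (\<lambda>s. F s (?y k s))" for k
    using continuous_on_along_curve[OF F picard_continuous[OF F]]
    by (rule continuous_on_subset) (use Suc.prems in auto)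
  have "\<bar>integral {0..t} (\<lambda>s. F s (?y (Suc n) s) - F s (?y n s))\<bar> \<le> ?B t - ?B 0"
  proof (rule abs_integral_le_primitive[where B' = "\<lambda>s. \<Lambda> * (?c * exp (2 * \<Lambda> * s))"])
    show "continuous_on {0..t} (\<lambda>s. F s (?y (Suc n) s) - F s (?y n s))"
      by (intro continuous_on_diff cont)
    show "(?B has_real_derivative \<Lambda> * (?c * exp (2 * \<Lambda> * s))) (at s within {0..t})" for s
      by (auto intro!: derivative_eq_intros)
    show "\<bar>F s (?y (Suc n) s) - F s (?y n s)\<bar> \<le> \<Lambda> * (?c * exp (2 * \<Lambda> * s))"
      if "s \<in> {0..t}" for s
      using lip[of s "?y (Suc n) s" "?y n s"] Suc.IH[of s] Suc.prems that \<Lambda>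
        mult_left_mono[of "\<bar>?y (Suc n) s - ?y n s\<bar>" "?c * exp (2 * \<Lambda> * s)" \<Lambda>]
      by (auto simp del: picard.simps)
  qed (use Suc.prems in auto)
  also have "\<dots> \<le> ?B t" using A0 \<Lambda> by simp
  finally have "\<bar>integral {0..t} (\<lambda>s. F s (?y (Suc n) s)) - integral {0..t} (\<lambda>s. F s (?y n s))\<bar> \<le> ?B t"
    by (subst (asm) integral_diff) (auto intro!: integrable_continuous_interval cont simp del: picard.simps)
  then show ?case
    by (subst (1 2) picard.simps(2)) (simp del: picard.simps)
qed

lemma picard_uniform_limit:
  fixes G :: "real \<Rightarrow> real \<Rightarrow> 'p::topological_space \<Rightarrow> real"
  assumes G: "continuous_on ({0..T} \<times> UNIV \<times> K) (\<lambda>(t, x, p). G t x p)"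
    and x0: "continuous_on K x0"
    and K: "compact K"
    and lip: "\<And>s x y p. s \<in> {0..T} \<Longrightarrow> p \<in> K \<Longrightarrow> \<bar>G s x p - G s y p\<bar> \<le> \<Lambda> * \<bar>x - y\<bar>"
    and \<Lambda>: "0 < \<Lambda>"
  shows "uniform_limit ({0..T} \<times> K) (\<lambda>n (t, p). picard (\<lambda>s x. G s x p) (x0 p) n t)
           (\<lambda>(t, p). picard_limit (\<lambda>s x. G s x p) (x0 p) t) sequentially"
proof -
  let ?y = "\<lambda>n z. picard (\<lambda>s x. G s x (snd z)) (x0 (snd z)) n (fst z)"
  have "continuous_on ({0..T} \<times> K) (\<lambda>z. G (fst z) (x0 (snd z)) (snd z))"
    by (rule continuous_on_compose2[OF G, where f = "\<lambda>z. (fst z, x0 (snd z), snd z)", simplified])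
      (auto intro!: continuous_intros continuous_on_compose2[OF x0])
  then have "bounded ((\<lambda>z. G (fst z) (x0 (snd z)) (snd z)) ` ({0..T} \<times> K))"
    by (intro compact_imp_bounded compact_continuous_image compact_Times K) auto
  then obtain A where A: "\<And>s p. s \<in> {0..T} \<Longrightarrow> p \<in> K \<Longrightarrow> \<bar>G s (x0 p) p\<bar> \<le> A"
    unfolding bounded_iff by fastforce
  have F: "continuous_on ({0..T} \<times> UNIV) (\<lambda>(t, x). G t x p)" if "p \<in> K" for p
    unfolding split_beta
    by (rule continuous_on_compose2[OF G, where f = "\<lambda>z. (fst z, snd z, p)", simplified])
      (use that in \<open>auto intro!: continuous_intros\<close>)
  let ?c = "\<bar>A\<bar> / (2 * \<Lambda>) * exp (2 * \<Lambda> * T)"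
  have "norm (?y (Suc n) z - ?y n z) \<le> ?c * (1/2) ^ n" if "z \<in> {0..T} \<times> K" for n z
  proof -
    have z: "fst z \<in> {0..T}" "snd z \<in> K" using that by auto
    have "\<bar>?y (Suc n) z - ?y n z\<bar> \<le> \<bar>A\<bar> / (2 * \<Lambda>) * (1/2) ^ n * exp (2 * \<Lambda> * fst z)"
      by (rule picard_increment_le[OF F[OF z(2)] lip[OF _ z(2)] \<Lambda> _ z(1)])
        (use A[OF _ z(2)] in fastforce)+
    also have "\<dots> \<le> \<bar>A\<bar> / (2 * \<Lambda>) * (1/2) ^ n * exp (2 * \<Lambda> * T)"
      using z \<Lambda> by (intro mult_left_mono) auto
    finally show ?thesis by (simp add: mult_ac)
  qed
  \<comment> \<open>The iterates are the partial sums of their increments, so the M-test applies.\<close>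
  then have "uniform_limit ({0..T} \<times> K) (\<lambda>N z. \<Sum>n<N. ?y (Suc n) z - ?y n z)
      (\<lambda>z. \<Sum>n. ?y (Suc n) z - ?y n z) sequentially"
    by (rule Weierstrass_m_test) (auto intro!: summable_mult summable_geometric)
  then have "uniform_limit ({0..T} \<times> K) (\<lambda>N z. x0 (snd z) + (\<Sum>n<N. ?y (Suc n) z - ?y n z))
      (\<lambda>z. x0 (snd z) + (\<Sum>n. ?y (Suc n) z - ?y n z)) sequentially"
    by (intro uniform_limit_intros)
  moreover have "x0 (snd z) + (\<Sum>n<N. ?y (Suc n) z - ?y n z) = ?y N z" for N z
    using sum_lessThan_telescope[of "\<lambda>n. ?y n z" N] by (simp del: picard.simps(2))
  ultimately have lim: "uniform_limit ({0..T} \<times> K) ?y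
      (\<lambda>z. x0 (snd z) + (\<Sum>n. ?y (Suc n) z - ?y n z)) sequentially"
    by simp
  have "picard_limit (\<lambda>s x. G s x (snd z)) (x0 (snd z)) (fst z)
      = x0 (snd z) + (\<Sum>n. ?y (Suc n) z - ?y n z)" if "z \<in> {0..T} \<times> K" for z
    unfolding picard_limit_def using tendsto_uniform_limitI[OF lim that] by (rule limI)
  with lim show ?thesis
    unfolding split_beta by (subst uniform_limit_cong'[where g = ?y]) auto
qed


lemma picard_uniform_limit_single:
  assumes F: "continuous_on ({0..T} \<times> UNIV) (\<lambda>(t, x). F t x)"
    and lip: "\<And>s x y. s \<in> {0..T} \<Longrightarrow> \<bar>F s x - F s y\<bar> \<le> \<Lambda> * \<bar>x - y\<bar>"
    and \<Lambda>: "0 < \<Lambda>"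
  shows "uniform_limit {0..T} (picard F x0) (picard_limit F x0) sequentially"
proof -
  have "continuous_on ({0..T} \<times> UNIV \<times> {0::real}) (\<lambda>(t, x, p). F t x)"
    by (rule continuous_on_ignore_parameter[OF F])
  then have "uniform_limit ({0..T} \<times> {0::real}) (\<lambda>n (t, p). picard F x0 n t)
      (\<lambda>(t, p). picard_limit F x0 t) sequentially"
    using lip \<Lambda> by (intro picard_uniform_limit) auto
  then show ?thesis
    by (auto simp: uniform_limit_iff)
qed

section \<open>Existence and uniqueness of solutions\<close>

lemma picard_limit_integral_equation:
  assumes F: "continuous_on ({0..T} \<times> UNIV) (\<lambda>(t, x). F t x)"
    and lip: "\<And>s x y. s \<in> {0..T} \<Longrightarrow> \<bar>F s x - F s y\<bar> \<le> \<Lambda> * \<bar>x - y\<bar>"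
    and \<Lambda>: "0 < \<Lambda>"
  shows "continuous_on {0..T} (picard_limit F x0)"
    and "t \<in> {0..T} \<Longrightarrow>
      picard_limit F x0 t = x0 + integral {0..t} (\<lambda>s. F s (picard_limit F x0 s))"
proof -
  let ?y = "picard F x0" and ?u = "picard_limit F x0"
  have lim: "uniform_limit {0..T} ?y ?u sequentially"
    by (rule picard_uniform_limit_single[OF F lip \<Lambda>])
  show "continuous_on {0..T} ?u"
    by (rule uniform_limit_theorem[OF _ lim]) (auto intro!: always_eventually picard_continuous F)
  assume t: "t \<in> {0..T}"
  have lim_F: "uniform_limit {0..t} (\<lambda>n s. F s (?y n s)) (\<lambda>s. F s (?u s)) sequentially"
    unfolding uniform_limit_iff
  proof (intro allI impI)
    fix e :: real assume "0 < e"
    then have "0 < e / \<Lambda>" using \<Lambda> by simp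
    with lim have "\<forall>\<^sub>F n in sequentially. \<forall>s\<in>{0..T}. dist (?y n s) (?u s) < e / \<Lambda>"
      unfolding uniform_limit_iff by blast
    then show "\<forall>\<^sub>F n in sequentially. \<forall>s\<in>{0..t}. dist (F s (?y n s)) (F s (?u s)) < e"
    proof eventually_elim
      case (elim n)
      show ?case
      proof
        fix s assume s: "s \<in> {0..t}"
        then have "\<bar>F s (?y n s) - F s (?u s)\<bar> \<le> \<Lambda> * \<bar>?y n s - ?u s\<bar>"
          using lip t by auto
        also have "\<dots> < \<Lambda> * (e / \<Lambda>)"
          using elim s t \<Lambda> by (intro mult_strict_left_mono) (auto simp: dist_real_def)
        finally show "dist (F s (?y n s)) (F s (?u s)) < e"
          using \<Lambda> by (simp add: dist_real_def)
      qed
    qed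
  qed
  have "continuous_on {0..t} (\<lambda>s. F s (?y n s))" for n
    using continuous_on_along_curve[OF F picard_continuous[OF F]]
    by (rule continuous_on_subset) (use t in auto)
  from uniform_limit_integral[OF lim_F this] obtain I J where
    I: "\<And>n. ((\<lambda>s. F s (?y n s)) has_integral I n) {0..t}" and
    J: "((\<lambda>s. F s (?u s)) has_integral J) {0..t}" and IJ: "I \<longlonglongrightarrow> J"
    by auto
  have "(\<lambda>n. ?y (Suc n) t) \<longlonglongrightarrow> x0 + J"
    using I IJ by (auto simp: has_integral_iff intro!: tendsto_intros)
  moreover have "(\<lambda>n. ?y (Suc n) t) \<longlonglongrightarrow> ?u t"
    using tendsto_uniform_limitI[OF lim t] by (rule LIMSEQ_Suc)
  ultimately show "?u t = x0 + integral {0..t} (\<lambda>s. F s (?u s))"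
    using J LIMSEQ_unique by (fastforce simp: has_integral_iff)
qed

lemma picard_limit_solves:
  assumes F: "continuous_on ({0..<b} \<times> UNIV) (\<lambda>(t, x). F t x)"
    and lip: "\<And>T. T \<in> {0..<b} \<Longrightarrow>
      \<exists>\<Lambda>>0. \<forall>s\<in>{0..T}. \<forall>x y. \<bar>F s x - F s y\<bar> \<le> \<Lambda> * \<bar>x - y\<bar>"
    and t: "t \<in> {0..<b}"
  shows "picard_limit F x0 0 = x0"
    and "(picard_limit F x0 has_real_derivative F t (picard_limit F x0 t)) (at t within {0..<b})"
proof -
  let ?u = "picard_limit F x0"
  \<comment> \<open>Any \<open>T\<close> strictly between \<open>t\<close> and \<open>b\<close> makes \<open>[0, T]\<close> a neighbourhood of \<open>t\<close> in \<open>[0, b)\<close>.\<close>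
  define T where "T = (t + b) / 2"
  have T: "t < T" "T < b" "0 \<le> T" using t by (auto simp: T_def)
  obtain \<Lambda> where \<Lambda>: "0 < \<Lambda>" and lip': "\<And>s x y. s \<in> {0..T} \<Longrightarrow> \<bar>F s x - F s y\<bar> \<le> \<Lambda> * \<bar>x - y\<bar>"
    using lip[of T] T by auto
  have F': "continuous_on ({0..T} \<times> UNIV) (\<lambda>(t, x). F t x)"
    using F by (rule continuous_on_subset) (use T in auto)
  note eq = picard_limit_integral_equation[OF F' lip' \<Lambda>]
  show "?u 0 = x0" using eq(2)[of 0] T by simp
  have "continuous_on {0..T} (\<lambda>s. F s (?u s))"
    by (rule continuous_on_along_curve[OF F' eq(1)])
  then have "((\<lambda>r. x0 + integral {0..r} (\<lambda>s. F s (?u s))) has_real_derivative F t (?u t)) (at t within {0..T})"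
    using t T by (auto intro!: derivative_eq_intros integral_has_real_derivative)
  then have "(?u has_real_derivative F t (?u t)) (at t within {0..T})"
    by (rule has_field_derivative_transform_within[of _ _ _ _ 1]) (use t T eq(2) in auto)
  moreover have "at t within {0..T} = at t within {0..<b}"
    by (rule at_within_nhd[of _ "{..<T}"]) (use t T in auto)
  ultimately show "(?u has_real_derivative F t (?u t)) (at t within {0..<b})" by simp
qed

text \<open>
  The square of the difference of two solutions, damped by \<open>exp (- 2 * \<Lambda> * s)\<close>, is nonincreasing,
  nonnegative, and zero at time zero.
\<close>

lemma ode_solution_unique:
  fixes F :: "real \<Rightarrow> real \<Rightarrow> real"
  assumes lip: "\<And>T. T \<in> {0..<b} \<Longrightarrow> \<exists>\<Lambda>. \<forall>s\<in>{0..T}. \<forall>x y. \<bar>F s x - F s y\<bar> \<le> \<Lambda> * \<bar>x - y\<bar>"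
    and y: "\<And>s. s \<in> {0..<b} \<Longrightarrow> (y has_real_derivative F s (y s)) (at s within {0..<b})"
    and z: "\<And>s. s \<in> {0..<b} \<Longrightarrow> (z has_real_derivative F s (z s)) (at s within {0..<b})"
    and init: "y 0 = z 0"
    and t: "t \<in> {0..<b}"
  shows "y t = z t"
proof -
  obtain \<Lambda> where \<Lambda>: "\<And>s x y. s \<in> {0..t} \<Longrightarrow> \<bar>F s x - F s y\<bar> \<le> \<Lambda> * \<bar>x - y\<bar>"
    using lip[OF t] by blast
  define e where "e s = (y s - z s)\<^sup>2 * exp (- 2 * \<Lambda> * s)" for s
  have "e t \<le> e 0"
  proof (rule DERIV_nonpos_imp_decreasing_open[of 0 t e])
    have "continuous_on {0..<b} e"
      unfolding e_def
      by (intro continuous_intros DERIV_continuous_on[OF y] DERIV_continuous_on[OF z])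
    then show "continuous_on {0..t} e"
      by (rule continuous_on_subset) (use t in auto)
  next
    fix s assume s: "0 < s" "s < t"
    then have at: "at s within {0..<b} = at s"
      using t by (intro at_within_interior) (auto simp: interior_atLeastLessThan)
    let ?d = "y s - z s" and ?D = "F s (y s) - F s (z s)"
    have "(e has_real_derivative 2 * exp (- 2 * \<Lambda> * s) * (?d * ?D - \<Lambda> * ?d\<^sup>2)) (at s)"
      unfolding e_def using y[of s] z[of s] s t at
      by (auto intro!: derivative_eq_intros simp: algebra_simps power2_eq_square)
    moreover have "?d * ?D \<le> \<Lambda> * ?d\<^sup>2"
    proof -
      have "?d * ?D \<le> \<bar>?d\<bar> * \<bar>?D\<bar>" by (metis abs_ge_self abs_mult)
      also have "\<dots> \<le> \<bar>?d\<bar> * (\<Lambda> * \<bar>?d\<bar>)"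
        using \<Lambda> s by (intro mult_left_mono) auto
      also have "\<dots> = \<Lambda> * ?d\<^sup>2" by (simp add: power2_eq_square)
      finally show ?thesis .
    qed
    moreover from this have "2 * exp (- 2 * \<Lambda> * s) * (?d * ?D - \<Lambda> * ?d\<^sup>2) \<le> 0"
      by (intro mult_nonneg_nonpos) auto
    ultimately show "\<exists>D. (e has_real_derivative D) (at s) \<and> D \<le> 0"
      by blast
  qed (use t in auto)
  then have "(y t - z t)\<^sup>2 * exp (- 2 * \<Lambda> * t) \<le> 0" using init by (simp add: e_def)
  then have "(y t - z t)\<^sup>2 \<le> 0"
    by (metis exp_gt_zero mult_le_0_iff not_less)
  then show ?thesis by simp
qed

section \<open>Integrable blow-up at the end of the interval\<close>

lemma integral_tail_le:
  fixes w :: "real \<Rightarrow> real"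
  assumes w: "continuous_on {0..<1} w"
    and le: "\<And>t. t \<in> {0..<1} \<Longrightarrow> \<bar>w t\<bar> \<le> M * (1 - t) powr (- b)"
    and b: "b < 1"
    and r: "r \<in> {0..<1}"
  shows "\<bar>integral {0..<1} w - integral {0..r} w\<bar> \<le> M / (1 - b) * (1 - r) powr (1 - b)"
proof -
  have major: "((\<lambda>t. M * (1 - t) powr (- b)) has_integral M / (1 - b) * (1 - r) powr (1 - b)) {r..<1}"
    if r: "r \<in> {0..<1}" for r
  proof -
    let ?P = "\<lambda>t. - (M / (1 - b) * (1 - t) powr (1 - b))"
    have "((\<lambda>t. M * (1 - t) powr (- b)) has_integral ?P 1 - ?P r) {r..1}"
    proof (rule fundamental_theorem_of_calculus_interior)
      show "continuous_on {r..1} ?P"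
        using b by (auto intro!: continuous_intros continuous_on_powr')
      fix t assume "t \<in> {r<..<1}"
      then show "(?P has_vector_derivative M * (1 - t) powr (- b)) (at t)"
        unfolding has_real_derivative_iff_has_vector_derivative[symmetric] using b
        by (auto intro!: derivative_eq_intros)
    qed (use r in auto)
    then have "((\<lambda>t. M * (1 - t) powr (- b)) has_integral M / (1 - b) * (1 - r) powr (1 - b)) {r..1}"
      using b by simp
    moreover have "negligible {t \<in> {r..1} - {r..<1}. M * (1 - t) powr (- b) \<noteq> 0}"
      by (rule negligible_subset[of "{1}"]) auto
    moreover have "{t \<in> {r..<1} - {r..1}. M * (1 - t) powr (- b) \<noteq> 0} = {}"
      by auto
    ultimately show ?thesis
      by (subst has_integral_spike_set_eq[where T = "{r..1}"]) (simp_all only: negligible_empty)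
  qed
  have meas: "w \<in> borel_measurable (lebesgue_on {r..<1})" if "r \<in> {0..<1}" for r
    by (rule continuous_imp_measurable_on_sets_lebesgue[OF continuous_on_subset[OF w]])
      (use that in auto)
  have "w integrable_on {r..<1}" if r: "r \<in> {0..<1}" for r
    by (rule measurable_bounded_by_integrable_imp_integrable_real[OF meas[OF r] _ le])
      (use major[OF r] r in \<open>auto simp: has_integral_iff\<close>)
  then have "integral ({0..r} \<union> {r..<1}) w = integral {0..r} w + integral {r..<1} w"
    using r
    by (intro integral_Un integrable_continuous_interval continuous_on_subset[OF w])
      (auto intro: negligible_subset[of "{r}"])
  moreover have "{0..r} \<union> {r..<1} = {0..<1}" using r by auto
  moreover have "norm (integral {r..<1} w) \<le> M / (1 - b) * (1 - r) powr (1 - b)"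
    by (rule integral_norm_bound_integral'[OF _ meas[OF r] _ major[OF r]]) (use le r in auto)
  ultimately show ?thesis by simp
qed


lemma integral_uniform_limit_of_powr_bound:
  fixes w :: "real \<Rightarrow> 'p::topological_space \<Rightarrow> real"
  assumes w: "\<And>r. r \<in> {0..<1} \<Longrightarrow> continuous_on ({0..r} \<times> K) (\<lambda>(t, p). w t p)"
    and le: "\<And>t p. t \<in> {0..<1} \<Longrightarrow> p \<in> K \<Longrightarrow> \<bar>w t p\<bar> \<le> M * (1 - t) powr (- b)"
    and b: "b < 1"
  shows "uniform_limit K (\<lambda>r p. integral {0..r} (\<lambda>t. w t p)) (\<lambda>p. integral {0..<1} (\<lambda>t. w t p)) (at_left 1)"
    and "continuous_on K (\<lambda>p. integral {0..<1} (\<lambda>t. w t p))"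
proof -
  have w1: "continuous_on {0..<1} (\<lambda>t. w t p)" if p: "p \<in> K" for p
  proof -
    have "continuous (at t within {0..<1}) (\<lambda>t. w t p)" if t: "t \<in> {0..<1}" for t
    proof -
      define r where "r = (t + 1) / 2"
      have r: "t < r" "r < 1" "0 \<le> r" using t by (auto simp: r_def)
      have "continuous_on {0..r} (\<lambda>t. w t p)"
        by (rule continuous_on_compose2[OF w, where f = "\<lambda>t. (t, p)", simplified, of r])
          (use r p in \<open>auto intro!: continuous_intros\<close>)
      then have "continuous (at t within {0..r}) (\<lambda>t. w t p)"
        using t r by (auto simp: continuous_on_eq_continuous_within)
      moreover have "at t within {0..r} = at t within {0..<1}"
        by (rule at_within_nhd[of _ "{..<r}"]) (use t r in auto)
      ultimately show ?thesis by simp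
    qed
    then show ?thesis by (simp add: continuous_on_eq_continuous_within)
  qed
  have near1: "\<forall>\<^sub>F r in at_left 1. r \<in> {0..<1::real}"
    using eventually_at_left_real[of 0 "1::real"] by (auto elim: eventually_mono)
  show lim: "uniform_limit K (\<lambda>r p. integral {0..r} (\<lambda>t. w t p)) (\<lambda>p. integral {0..<1} (\<lambda>t. w t p)) (at_left 1)"
  proof (rule uniform_limitI)
    fix e :: real assume e: "0 < e"
    have "((\<lambda>r. M / (1 - b) * (1 - r) powr (1 - b)) \<longlongrightarrow> M / (1 - b) * (1 - 1) powr (1 - b)) (at_left 1)"
      using b by (intro tendsto_intros tendsto_powr2) (auto intro: eventually_mono[OF near1])
    then have "\<forall>\<^sub>F r in at_left 1. M / (1 - b) * (1 - r) powr (1 - b) < e"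
      by (rule order_tendstoD) (use e in simp)
    with near1 show "\<forall>\<^sub>F r in at_left 1. \<forall>p\<in>K.
        dist (integral {0..r} (\<lambda>t. w t p)) (integral {0..<1} (\<lambda>t. w t p)) < e"
    proof eventually_elim
      case (elim r)
      then show ?case
        using integral_tail_le[OF w1 le b] by (fastforce simp: dist_real_def abs_minus_commute)
    qed
  qed
  have "continuous_on K (\<lambda>p. integral {0..r} (\<lambda>t. w t p))" if r: "r \<in> {0..<1}" for r
  proof -
    have "continuous_on (K \<times> cbox 0 r) (\<lambda>z. w (snd z) (fst z))"
      by (rule continuous_on_compose2[OF w[OF r], where f = "\<lambda>z. (snd z, fst z)", simplified])
        (auto intro!: continuous_intros)
    then show ?thesis
      using integral_continuous_on_param[of K 0 r "\<lambda>p t. w t p"] by (simp add: split_beta)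
  qed
  then show "continuous_on K (\<lambda>p. integral {0..<1} (\<lambda>t. w t p))"
    by (intro uniform_limit_theorem[OF _ lim]) (auto intro: eventually_mono[OF near1])
qed

text \<open>
  If \<open>F\<close> grows at most like \<open>c * \<bar>x\<bar> / (1 - s) + D\<close>, then the solution blows up at time \<open>1\<close> no faster
  than the power \<open>-b\<close> of the remaining time, for every \<open>b > c\<close>. The function
  \<open>M * (1 - s) powr (-b)\<close> is a supersolution, because its derivative exceeds \<open>c / (1 - s)\<close> times itself
  by \<open>(b - c) * M * (1 - s) powr (-b - 1)\<close>, which is at least \<open>(b - c) * M\<close> and hence at least \<open>D\<close>.
\<close>

lemma picard_limit_le_powr:
  assumes F: "continuous_on ({0..<1} \<times> UNIV) (\<lambda>(t, x). F t x)"
    and lip: "\<And>T. T \<in> {0..<1} \<Longrightarrow>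
      \<exists>\<Lambda>>0. \<forall>s\<in>{0..T}. \<forall>x y. \<bar>F s x - F s y\<bar> \<le> \<Lambda> * \<bar>x - y\<bar>"
    and growth: "\<And>s x. s \<in> {0..<1} \<Longrightarrow> \<bar>F s x\<bar> \<le> c * \<bar>x\<bar> / (1 - s) + D"
    and c: "0 \<le> c" "c < b" and D: "0 \<le> D"
    and t: "t \<in> {0..<1}"
  shows "\<bar>picard_limit F x0 t\<bar> \<le> (\<bar>x0\<bar> + D / (b - c)) * (1 - t) powr (- b)"
proof -
  define M where "M = \<bar>x0\<bar> + D / (b - c)"
  have M: "\<bar>x0\<bar> \<le> M" "D \<le> (b - c) * M" "0 \<le> M"
    using c D by (auto simp: M_def distrib_left)
  obtain \<Lambda> where \<Lambda>: "0 < \<Lambda>" and lip': "\<And>s x y. s \<in> {0..t} \<Longrightarrow> \<bar>F s x - F s y\<bar> \<le> \<Lambda> * \<bar>x - y\<bar>"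
    using lip[OF t] by auto
  have F': "continuous_on ({0..t} \<times> UNIV) (\<lambda>(t, x). F t x)"
    using F by (rule continuous_on_subset) (use t in auto)
  have "\<bar>picard F x0 n t\<bar> \<le> M * (1 - t) powr (- b)" for n
  proof (rule picard_le_supersolution[OF F', where B' = "\<lambda>s. b * M * (1 - s) powr (- b - 1)"])
    fix s assume s: "s \<in> {0..t}"
    show "((\<lambda>s. M * (1 - s) powr (- b)) has_real_derivative b * M * (1 - s) powr (- b - 1)) (at s within {0..t})"
      using s t by (auto intro!: derivative_eq_intros)
    show "0 \<le> b * M * (1 - s) powr (- b - 1)"
      using M c by simp
    fix x assume x: "\<bar>x\<bar> \<le> M * (1 - s) powr (- b)"
    have "1 - s \<noteq> 0" "0 < 1 - s" using s t by auto
    then have q: "(1 - s) powr (- b) / (1 - s) = (1 - s) powr (- b - 1)"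
      by (simp add: powr_diff)
    have q1: "1 \<le> (1 - s) powr (- b - 1)"
      using s t c powr_mono'[of "- b - 1" 0 "1 - s"] by auto
    have "\<bar>F s x\<bar> \<le> c * \<bar>x\<bar> / (1 - s) + D"
      using growth s t by auto
    also have "c * \<bar>x\<bar> / (1 - s) \<le> c * (M * (1 - s) powr (- b)) / (1 - s)"
      using x c s t by (intro divide_right_mono mult_left_mono) auto
    also have "\<dots> = c * M * (1 - s) powr (- b - 1)"
      using q[symmetric] by simp
    also have "D \<le> (b - c) * M * 1" using M by simp
    also have "(b - c) * M * 1 \<le> (b - c) * M * (1 - s) powr (- b - 1)"
      using M c q1 by (intro mult_left_mono) auto
    finally show "\<bar>F s x\<bar> \<le> b * M * (1 - s) powr (- b - 1)"
      by (simp add: algebra_simps)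
  qed (use M t in auto)
  moreover have "(\<lambda>n. picard F x0 n t) \<longlonglongrightarrow> picard_limit F x0 t"
    by (rule tendsto_uniform_limitI[OF picard_uniform_limit_single[OF F' lip' \<Lambda>]]) (use t in auto)
  ultimately show ?thesis
    unfolding M_def[symmetric] by (intro tendsto_upperbound[OF tendsto_rabs]) auto
qed

section \<open>Continuity of the integral of the solution\<close>

theorem theorem2p5:
  fixes \<theta> u0 C :: "real \<Rightarrow> real"
    and f :: "real \<Rightarrow> real \<Rightarrow> real \<Rightarrow> ereal"
    and L :: "real \<Rightarrow> real \<Rightarrow> real"
    and a :: real
  assumes theta_pos: "\<And>l. 0 < l \<Longrightarrow> 0 < \<theta> l"
    and f_real: "\<And>t x l. 0 < l \<Longrightarrow> 0 \<le> t \<Longrightarrow> t < \<theta> l \<Longrightarrow> \<bar>f t x l\<bar> \<noteq> \<infinity>"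
    and f_singular: "\<And>l. 0 < l \<Longrightarrow>
          (AE x in lborel. ((\<lambda>t. f t x l) \<longlongrightarrow> \<infinity>) (at_left (\<theta> l)) \<or>
                           ((\<lambda>t. f t x l) \<longlongrightarrow> -\<infinity>) (at_left (\<theta> l)))"
    and f_lipschitz: "\<And>l \<epsilon> t x y. 0 < l \<Longrightarrow> 0 < \<epsilon> \<Longrightarrow> \<epsilon> < \<theta> l \<Longrightarrow> t \<in> {0..\<theta> l - \<epsilon>} \<Longrightarrow>
          \<bar>f t x l - f t y l\<bar> \<le> ereal (L l \<epsilon> * \<bar>x - y\<bar>)"
    and theta_cont: "continuous_on {0<..} \<theta>"
    and u0_cont: "continuous_on {0<..} u0"
    and L_cont: "\<And>\<epsilon>. 0 < \<epsilon> \<Longrightarrow> continuous_on {l. 0 < l \<and> \<epsilon> < \<theta> l} (\<lambda>l. L l \<epsilon>)"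
    and f_cont: "continuous_on {(t, x, l). 0 < l \<and> 0 \<le> t \<and> t < \<theta> l} (\<lambda>(t, x, l). f t x l)"
    and a_gt_1: "1 < a"
    and f_growth: "\<And>l t x. 0 < l \<Longrightarrow> 0 \<le> t \<Longrightarrow> t < \<theta> l \<Longrightarrow>
          \<bar>f t x l\<bar> \<le> ereal (\<bar>x\<bar> / (a * (\<theta> l - t)) + C l)"
    and C_nonneg: "\<And>l. 0 < l \<Longrightarrow> 0 \<le> C l"
    and C_cont: "continuous_on {0<..} C"
  shows "\<exists>u :: real \<Rightarrow> real \<Rightarrow> real.
           (\<forall>l>0. unique_ivp_solution (\<lambda>t x. f t x l) (\<theta> l) (u0 l) (u l)) \<and>
           (\<forall>l>0. improper_integral_converges (\<theta> l) (u l)) \<and>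
           continuous_on {0<..} (\<lambda>l. improper_integral (\<theta> l) (u l))"
proof -
  define G where "G \<tau> x l = \<theta> l * real_of_ereal (f (\<tau> * \<theta> l) x l)" for \<tau> x l
  have rescaled_time: "0 \<le> \<tau> * \<theta> l" "\<tau> * \<theta> l < \<theta> l" if "\<tau> \<in> {0..<1}" "0 < l" for \<tau> l
    using that theta_pos[of l] by auto
  have G_cont: "continuous_on ({0..<1} \<times> UNIV \<times> {0<..}) (\<lambda>(\<tau>, x, l). G \<tau> x l)"
  proof -
    have "continuous_on {(t, x, l). 0 < l \<and> 0 \<le> t \<and> t < \<theta> l} (real_of_ereal \<circ> (\<lambda>(t, x, l). f t x l))"
    proof (subst continuous_on_iff_real[symmetric])
      fix z :: "real \<times> real \<times> real"
      assume "z \<in> {(t, x, l). 0 < l \<and> 0 \<le> t \<and> t < \<theta> l}"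
      then show "\<bar>case z of (t, x, l) \<Rightarrow> f t x l\<bar> \<noteq> \<infinity>"
        using f_real[of "snd (snd z)" "fst z" "fst (snd z)"] by (simp add: split_beta)
    qed (rule f_cont)
    then have *: "continuous_on {(t, x, l). 0 < l \<and> 0 \<le> t \<and> t < \<theta> l}
        (\<lambda>z. real_of_ereal (f (fst z) (fst (snd z)) (snd (snd z))))"
      by (simp add: o_def split_beta)
    have th: "continuous_on ({0..<1} \<times> UNIV \<times> {0<..}) (\<lambda>w. \<theta> (snd (snd w)))"
      by (rule continuous_on_compose2[OF theta_cont]) (auto intro!: continuous_intros)
    have "continuous_on ({0..<1} \<times> UNIV \<times> {0<..}) (\<lambda>w. real_of_ereal
        (f (fst w * \<theta> (snd (snd w))) (fst (snd w)) (snd (snd w))))"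
      by (rule continuous_on_compose2[OF *, where f = "\<lambda>w. (fst w * \<theta> (snd (snd w)), fst (snd w), snd (snd w))",
            simplified])
        (use rescaled_time in \<open>auto intro!: continuous_intros th\<close>)
    then show ?thesis
      unfolding G_def split_beta by (intro continuous_intros th)
  qed
  have G_growth: "\<bar>G \<tau> x l\<bar> \<le> 1 / a * \<bar>x\<bar> / (1 - \<tau>) + \<theta> l * C l" if \<tau>: "\<tau> \<in> {0..<1}" and l: "0 < l" for \<tau> x l
  proof -
    obtain y where y: "f (\<tau> * \<theta> l) x l = ereal y"
      using f_real[OF l rescaled_time[OF \<tau> l]] by auto
    have "\<bar>y\<bar> \<le> \<bar>x\<bar> / (a * (\<theta> l - \<tau> * \<theta> l)) + C l"
      using f_growth[OF l rescaled_time[OF \<tau> l], of x] y by simp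
    then have "\<theta> l * \<bar>y\<bar> \<le> \<theta> l * (\<bar>x\<bar> / (a * (\<theta> l - \<tau> * \<theta> l)) + C l)"
      using theta_pos[OF l] by simp
    also have "a * (\<theta> l - \<tau> * \<theta> l) = \<theta> l * (a * (1 - \<tau>))"
      by (simp add: algebra_simps)
    also have "\<theta> l * (\<bar>x\<bar> / (\<theta> l * (a * (1 - \<tau>))) + C l) = 1 / a * \<bar>x\<bar> / (1 - \<tau>) + \<theta> l * C l"
      using theta_pos[OF l] by (simp add: distrib_left)
    finally show ?thesis
      using theta_pos[OF l] y by (simp add: G_def abs_mult)
  qed
  have G_lip: "\<exists>\<Lambda>>0. \<forall>s\<in>{0..T}. \<forall>l\<in>K. \<forall>x y. \<bar>G s x l - G s y l\<bar> \<le> \<Lambda> * \<bar>x - y\<bar>"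
    if K: "compact K" "K \<subseteq> {0<..}" and T: "T \<in> {0..<1}" for K T
  proof (cases "K = {}")
    case False
    have th: "continuous_on K \<theta>" using theta_cont K continuous_on_subset by blast
    obtain l0 where l0: "l0 \<in> K" "\<And>l. l \<in> K \<Longrightarrow> \<theta> l0 \<le> \<theta> l"
      using continuous_attains_inf[OF K(1) False th] by blast
    \<comment> \<open>One \<open>\<epsilon>\<close> serves all of \<open>K\<close>: rescaled times up to \<open>T\<close> stay away from \<open>\<theta> l\<close> by at least
        \<open>(1 - T) * \<theta> l0\<close>. Halving it keeps \<open>\<epsilon> < \<theta> l\<close> when \<open>T = 0\<close>.\<close>
    define \<epsilon> where "\<epsilon> = (1 - T) * \<theta> l0 / 2"
    have th0: "0 < \<theta> l0" using l0 K theta_pos by auto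
    then have \<epsilon>: "0 < \<epsilon>" using T by (auto simp: \<epsilon>_def)
    have \<epsilon>_le: "\<epsilon> < (1 - T) * \<theta> l" if "l \<in> K" for l
    proof -
      have "\<epsilon> < (1 - T) * \<theta> l0" using th0 T by (auto simp: \<epsilon>_def)
      also have "\<dots> \<le> (1 - T) * \<theta> l" using l0(2)[OF that] T by (intro mult_left_mono) auto
      finally show ?thesis .
    qed
    have \<epsilon>_less: "\<epsilon> < \<theta> l" if "l \<in> K" for l
    proof -
      have "(1 - T) * \<theta> l \<le> 1 * \<theta> l"
        using T that K theta_pos[of l] by (intro mult_right_mono) auto
      with \<epsilon>_le[OF that] show ?thesis by simp
    qed
    have "continuous_on K (\<lambda>l. \<theta> l * L l \<epsilon>)"
      by (intro continuous_intros th continuous_on_subset[OF L_cont[OF \<epsilon>]]) (use K \<epsilon>_less in auto)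
    then have "bounded ((\<lambda>l. \<theta> l * L l \<epsilon>) ` K)"
      using K(1) compact_imp_bounded compact_continuous_image by blast
    then obtain \<Lambda> where \<Lambda>: "0 < \<Lambda>" "\<And>l. l \<in> K \<Longrightarrow> \<bar>\<theta> l * L l \<epsilon>\<bar> \<le> \<Lambda>"
      unfolding bounded_pos by auto
    have "\<bar>G s x l - G s y l\<bar> \<le> \<Lambda> * \<bar>x - y\<bar>" if s: "s \<in> {0..T}" and l: "l \<in> K" for s l x y
    proof -
      have l_pos: "0 < l" and s1: "s \<in> {0..<1}" using K l s T by auto
      note th_l = theta_pos[OF l_pos] and s_th = rescaled_time[OF s1 l_pos]
      have "s * \<theta> l \<le> T * \<theta> l" using s th_l by simp
      also have "\<dots> \<le> \<theta> l - \<epsilon>" using \<epsilon>_le[OF l] by (simp add: algebra_simps)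
      finally have "s * \<theta> l \<in> {0..\<theta> l - \<epsilon>}" using s_th by simp
      from f_lipschitz[OF l_pos \<epsilon> \<epsilon>_less[OF l] this, of x y] f_real[OF l_pos s_th, of x] f_real[OF l_pos s_th, of y]
      have "\<bar>real_of_ereal (f (s * \<theta> l) x l) - real_of_ereal (f (s * \<theta> l) y l)\<bar> \<le> L l \<epsilon> * \<bar>x - y\<bar>"
        by (cases "f (s * \<theta> l) x l"; cases "f (s * \<theta> l) y l") auto
      then have "\<bar>G s x l - G s y l\<bar> \<le> \<theta> l * (L l \<epsilon> * \<bar>x - y\<bar>)"
        unfolding G_def right_diff_distrib[symmetric] using th_l by (simp add: abs_mult)
      also have "\<dots> = (\<theta> l * L l \<epsilon>) * \<bar>x - y\<bar>" by simp
      also have "\<dots> \<le> \<Lambda> * \<bar>x - y\<bar>" using \<Lambda>(2)[OF l] by (intro mult_right_mono) auto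
      finally show ?thesis .
    qed
    with \<Lambda>(1) show ?thesis by blast
  qed (auto intro: exI[of _ 1])

  have G_cont1: "continuous_on ({0..<1} \<times> UNIV) (\<lambda>(\<tau>, x). G \<tau> x l)" if "0 < l" for l
    unfolding split_beta
    by (rule continuous_on_compose2[OF G_cont, where f = "\<lambda>w. (fst w, snd w, l)", simplified])
      (use that in \<open>auto intro!: continuous_intros\<close>)
  have G_lip1: "\<exists>\<Lambda>>0. \<forall>s\<in>{0..T}. \<forall>x y. \<bar>G s x l - G s y l\<bar> \<le> \<Lambda> * \<bar>x - y\<bar>"
    if "0 < l" "T \<in> {0..<1}" for l T
    using G_lip[of "{l}" T] that by auto

  define v where "v \<tau> l = picard_limit (\<lambda>s x. G s x l) (u0 l) \<tau>" for \<tau> l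
  have v_init: "v 0 l = u0 l"
    and v_deriv: "\<tau> \<in> {0..<1} \<Longrightarrow> ((\<lambda>\<tau>. v \<tau> l) has_real_derivative G \<tau> (v \<tau> l) l) (at \<tau> within {0..<1})"
    if l: "0 < l" for \<tau> l
    using picard_limit_solves[OF G_cont1[OF l] G_lip1[OF l]] by (force simp: v_def)+

  have v_cont: "continuous_on ({0..r} \<times> K) (\<lambda>(\<tau>, l). v \<tau> l)"
    if K: "compact K" "K \<subseteq> {0<..}" and r: "r \<in> {0..<1}" for K r
  proof -
    obtain \<Lambda> where \<Lambda>: "0 < \<Lambda>"
      "\<And>s x y l. s \<in> {0..r} \<Longrightarrow> l \<in> K \<Longrightarrow> \<bar>G s x l - G s y l\<bar> \<le> \<Lambda> * \<bar>x - y\<bar>"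
      using G_lip[OF K r] by blast
    have G': "continuous_on ({0..r} \<times> UNIV \<times> K) (\<lambda>(\<tau>, x, l). G \<tau> x l)"
      by (rule continuous_on_subset[OF G_cont]) (use K r in auto)
    have u0': "continuous_on K u0" by (rule continuous_on_subset[OF u0_cont K(2)])
    show ?thesis
      unfolding v_def
      by (rule uniform_limit_theorem[OF _ picard_uniform_limit[OF G' u0' K(1) \<Lambda>(2,1)]])
        (auto intro!: always_eventually picard_jointly_continuous[OF G' u0'])
  qed

  \<comment> \<open>Any exponent strictly between \<open>1 / a\<close> and \<open>1\<close> would do.\<close>
  define b where "b = (1 + 1 / a) / 2"
  have b: "1 / a < b" "b < 1" using a_gt_1 by (auto simp: b_def field_simps)
  define M where "M l = \<bar>u0 l\<bar> + \<theta> l * C l / (b - 1 / a)" for l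
  have v_le: "\<bar>v \<tau> l\<bar> \<le> M l * (1 - \<tau>) powr (- b)" if l: "0 < l" and \<tau>: "\<tau> \<in> {0..<1}" for \<tau> l
    unfolding v_def M_def
    by (rule picard_limit_le_powr[OF G_cont1[OF l] G_lip1[OF l] G_growth[OF _ l] _ b(1) _ \<tau>])
      (use a_gt_1 C_nonneg[OF l] theta_pos[OF l] in auto)

  define J where "J l = integral {0..<1} (\<lambda>\<tau>. v \<tau> l)" for l
  have J_lim: "uniform_limit K (\<lambda>r l. integral {0..r} (\<lambda>\<tau>. v \<tau> l)) J (at_left 1)"
    and J_cont: "continuous_on K J" if K: "compact K" "K \<subseteq> {0<..}" for K
  proof -
    have "continuous_on K M"
      unfolding M_def using b
      by (intro continuous_intros continuous_on_subset[OF u0_cont K(2)]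
          continuous_on_subset[OF theta_cont K(2)] continuous_on_subset[OF C_cont K(2)]) auto
    then have "bounded (M ` K)"
      using K(1) compact_imp_bounded compact_continuous_image by blast
    then obtain N where N: "\<And>l. l \<in> K \<Longrightarrow> M l \<le> N"
      unfolding bounded_iff by (auto intro: order_trans[OF abs_ge_self])
    have "\<bar>v \<tau> l\<bar> \<le> N * (1 - \<tau>) powr (- b)" if "\<tau> \<in> {0..<1}" "l \<in> K" for \<tau> l
      by (rule order_trans[OF v_le mult_right_mono]) (use that K(2) N in auto)
    from integral_uniform_limit_of_powr_bound[OF v_cont[OF K] this b(2)]
    show "uniform_limit K (\<lambda>r l. integral {0..r} (\<lambda>\<tau>. v \<tau> l)) J (at_left 1)" "continuous_on K J"
      by (simp_all add: J_def[abs_def])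
  qed

  define u where "u l t = v (t / \<theta> l) l" for l t
  have u_sol: "ivp_solution (\<lambda>t x. f t x l) (\<theta> l) (u0 l) (u l)" if l: "0 < l" for l
  proof -
    note th = theta_pos[OF l]
    have D: "(u l has_real_derivative real_of_ereal (f t (u l t) l)) (at t within {0..<\<theta> l})"
      if t: "t \<in> {0..<\<theta> l}" for t
    proof -
      have t1: "t / \<theta> l \<in> {0..<1}" using t th by auto
      have "((\<lambda>\<tau>. v \<tau> l) has_real_derivative G (t / \<theta> l) (v (t / \<theta> l) l) l)
          (at (t / \<theta> l) within (\<lambda>t. t / \<theta> l) ` {0..<\<theta> l})"
        by (rule DERIV_subset[OF v_deriv[OF l t1]]) (use th in auto)
      then have "((\<lambda>\<tau>. v \<tau> l) \<circ> (\<lambda>t. t / \<theta> l) has_real_derivative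
          G (t / \<theta> l) (v (t / \<theta> l) l) l * (1 / \<theta> l)) (at t within {0..<\<theta> l})"
        by (rule DERIV_image_chain) (use th in \<open>auto intro!: derivative_eq_intros\<close>)
      then show ?thesis
        using th by (simp add: u_def[abs_def] G_def o_def)
    qed
    have "continuous_on {0..<\<theta> l} (u l)" using D by (rule DERIV_continuous_on)
    moreover have "u l 0 = u0 l" using v_init[OF l] by (simp add: u_def)
    moreover have "ereal (real_of_ereal (f t (u l t) l)) = f t (u l t) l" if "t \<in> {0..<\<theta> l}" for t
      using f_real[OF l, of t "u l t"] that by (simp add: ereal_real)
    ultimately show ?thesis
      using D unfolding ivp_solution_def by blast
  qed
  have u_unique: "y t = u l t"
    if l: "0 < l" and y: "ivp_solution (\<lambda>t x. f t x l) (\<theta> l) (u0 l) y" and t: "t \<in> {0..<\<theta> l}" for l y t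
  proof (rule ode_solution_unique[where F = "\<lambda>t x. real_of_ereal (f t x l)" and b = "\<theta> l"
        and y = y and z = "u l" and t = t])
    fix T assume T: "T \<in> {0..<\<theta> l}"
    define \<epsilon> where "\<epsilon> = (\<theta> l - T) / 2"
    have \<epsilon>: "0 < \<epsilon>" "\<epsilon> < \<theta> l" "T \<le> \<theta> l - \<epsilon>" using T by (auto simp: \<epsilon>_def field_simps)
    have "\<bar>real_of_ereal (f s x l) - real_of_ereal (f s y l)\<bar> \<le> L l \<epsilon> * \<bar>x - y\<bar>"
      if s: "s \<in> {0..T}" for s x y
      using f_lipschitz[OF l \<epsilon>(1,2), of s x y] f_real[OF l, of s x] f_real[OF l, of s y] s T \<epsilon>(3)
      by (cases "f s x l"; cases "f s y l") auto
    then show "\<exists>\<Lambda>. \<forall>s\<in>{0..T}. \<forall>x y.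
        \<bar>real_of_ereal (f s x l) - real_of_ereal (f s y l)\<bar> \<le> \<Lambda> * \<bar>x - y\<bar>"
      by blast
  next
    have "(z has_real_derivative real_of_ereal (f s (z s) l)) (at s within {0..<\<theta> l})"
      if "ivp_solution (\<lambda>t x. f t x l) (\<theta> l) (u0 l) z" "s \<in> {0..<\<theta> l}" for z s
      using that unfolding ivp_solution_def by (metis real_of_ereal.simps(1))
    from this[OF y] this[OF u_sol[OF l]]
    show "(y has_real_derivative real_of_ereal (f s (y s) l)) (at s within {0..<\<theta> l})"
      "(u l has_real_derivative real_of_ereal (f s (u l s) l)) (at s within {0..<\<theta> l})"
      if "s \<in> {0..<\<theta> l}" for s
      using that by auto
  qed (use t y u_sol[OF l] in \<open>auto simp: ivp_solution_def\<close>)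

  have u_int: "integral {0..t} (u l) = \<theta> l * integral {0..t / \<theta> l} (\<lambda>\<tau>. v \<tau> l)" if "0 < l" for l t
    using integral_rescale[of "\<theta> l" "t / \<theta> l" "u l"] theta_pos[OF that] by (simp add: u_def)
  have u_lim: "((\<lambda>t. integral {0..t} (u l)) \<longlongrightarrow> \<theta> l * J l) (at_left (\<theta> l))" if l: "0 < l" for l
  proof -
    have "((\<lambda>r. integral {0..r} (\<lambda>\<tau>. v \<tau> l)) \<longlongrightarrow> J l) (at_left 1)"
      by (rule tendsto_uniform_limitI[OF J_lim[of "{l}"]]) (use l in auto)
    moreover have "filterlim (\<lambda>t. t / \<theta> l) (at_left 1) (at_left (\<theta> l))"
      unfolding filterlim_at
      using theta_pos[OF l] by (auto intro!: tendsto_eq_intros simp: eventually_at_filter)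
    ultimately have "((\<lambda>t. integral {0..t / \<theta> l} (\<lambda>\<tau>. v \<tau> l)) \<longlongrightarrow> J l) (at_left (\<theta> l))"
      by (rule filterlim_compose)
    then show ?thesis
      unfolding u_int[OF l] by (intro tendsto_intros)
  qed
  have u_improper: "improper_integral (\<theta> l) (u l) = \<theta> l * J l" if "0 < l" for l
    unfolding improper_integral_def by (rule tendsto_Lim[OF _ u_lim[OF that]]) simp
  have "improper_integral_converges (\<theta> l) (u l)" if l: "0 < l" for l
  proof -
    have "continuous_on {0..<\<theta> l} (u l)"
      using u_sol[OF l] unfolding ivp_solution_def by (rule conjunct1)
    then have "u l integrable_on {0..t}" if "t \<in> {0..<\<theta> l}" for t
      by (rule integrable_continuous_interval[OF continuous_on_subset]) (use that in auto)
    then show ?thesis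
      unfolding improper_integral_converges_def using u_lim[OF l] by (intro conjI ballI exI)
  qed
  moreover have "continuous_on {0<..} (\<lambda>l. improper_integral (\<theta> l) (u l))"
  proof -
    have "continuous (at l) J" if l: "0 < l" for l
      by (rule continuous_on_interior[OF J_cont[of "{l/2..2*l}"]]) (use l in auto)
    then have "continuous_on {0<..} (\<lambda>l. \<theta> l * J l)"
      by (intro continuous_intros theta_cont continuous_at_imp_continuous_on) auto
    then show ?thesis
      by (rule continuous_on_eq) (simp add: u_improper)
  qed
  moreover have "unique_ivp_solution (\<lambda>t x. f t x l) (\<theta> l) (u0 l) (u l)" if "0 < l" for l
    unfolding unique_ivp_solution_def using u_sol[OF that] u_unique[OF that] by (intro conjI allI impI ballI)
  ultimately show ?thesis
    by (intro exI[of _ u] conjI allI impI)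
qed

end
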